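(* Let $\Lambda$ be a discrete topological space of uncountable cardinality $\gamma$ and let $\alpha$ be an infinite cardinal with $\alpha<\gamma$. Then $$K_{\Lambda,\alpha}=\bigcup_{\substack{S\subset\Lambda\\ \operatorname{card}(S)\le\alpha}}\beta S\subset\beta\Lambda,$$ i.e. $C_{b,\alpha}(\Lambda)\cong C_0\Big(\bigcup_{S\subset\Lambda,\ \operatorname{card}(S)\le\alpha}\beta S\Big)$.
   Context: $C_b(\Lambda)$ is the $C^*$-algebra of all bounded complex functions on $\Lambda$, and $C_{b,\alpha}(\Lambda)\subset C_b(\Lambda)$ is the closed ideal (a commutative $C^*$-algebra) of all bounded functions whose support $\operatorname{supp}(f)=\{t:f(t)\neq0\}$ has cardinality at most $\alpha$. $\beta\Lambda$ is the Stone–Čech compactification of $\Lambda$, identified with the space of characters of $C_b(\Lambda)\cong C(\beta\Lambda)$, where $p\in\beta\Lambda$ acts by $p(f)=\widehat{f}(p)$, $\widehat f$ being the continuous extension of $f$ to $\beta\Lambda$. For $S\subset\Lambda$, $\beta S$ is regarded as a subset of $\beta\Lambda$ (the closure of $S$ in $\beta\Lambda$). $K_{\Lambda,\alpha}$ denotes the space of characters of $C_{b,\alpha}(\Lambda)$ (so that $C_{b,\alpha}(\Lambda)\cong C_0(K_{\Lambda,\alpha})$); since $C_{b,\alpha}(\Lambda)$ is a closed ideal of $C_b(\Lambda)$, it is identified with the open subset of $\beta\Lambda$ consisting of those characters of $C_b(\Lambda)$ that are not identically zero on $C_{b,\alpha}(\Lambda)$. *)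

theory Defs
  imports "HOL-Analysis.Analysis"
begin

unbundle cardinal_syntax

section \<open>Algebras of complex functions\<close>

text \<open>
  A complex function on a carrier \<open>D\<close> is represented by an element of \<open>extensional D\<close>, so that
  equality of functions is equality on \<open>D\<close>.  The \<open>*\<close>-algebra operations are pointwise.
\<close>

definition fun_add :: "'a set \<Rightarrow> ('a \<Rightarrow> complex) \<Rightarrow> ('a \<Rightarrow> complex) \<Rightarrow> 'a \<Rightarrow> complex" where
  "fun_add D f g = (\<lambda>t\<in>D. f t + g t)"

definition fun_mult :: "'a set \<Rightarrow> ('a \<Rightarrow> complex) \<Rightarrow> ('a \<Rightarrow> complex) \<Rightarrow> 'a \<Rightarrow> complex" where
  "fun_mult D f g = (\<lambda>t\<in>D. f t * g t)"

definition fun_scale :: "'a set \<Rightarrow> complex \<Rightarrow> ('a \<Rightarrow> complex) \<Rightarrow> 'a \<Rightarrow> complex" where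
  "fun_scale D c f = (\<lambda>t\<in>D. c * f t)"

definition fun_cnj :: "'a set \<Rightarrow> ('a \<Rightarrow> complex) \<Rightarrow> 'a \<Rightarrow> complex" where
  "fun_cnj D f = (\<lambda>t\<in>D. cnj (f t))"

definition Cb :: "'a topology \<Rightarrow> ('a \<Rightarrow> complex) set" where
  "Cb X = {f \<in> extensional (topspace X).
             continuous_map X euclidean f \<and> bounded (f ` topspace X)}"

definition C0 :: "'a topology \<Rightarrow> ('a \<Rightarrow> complex) set" where
  "C0 X = {f \<in> extensional (topspace X).
             continuous_map X euclidean f \<and>
             (\<forall>\<epsilon>>0. compactin X {x \<in> topspace X. \<epsilon> \<le> cmod (f x)})}"

text \<open>\<open>Cb_supp \<Lambda> \<alpha>\<close> is $C_{b,\alpha}(\Lambda)$; the support of \<open>f\<close> is the set where \<open>f\<close> does not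
  vanish, without closure.\<close>

definition Cb_supp :: "'a set \<Rightarrow> 'c rel \<Rightarrow> ('a \<Rightarrow> complex) set" where
  "Cb_supp \<Lambda> \<alpha> = {f \<in> Cb (discrete_topology \<Lambda>). |{t \<in> \<Lambda>. f t \<noteq> 0}| \<le>o \<alpha>}"

text \<open>Isomorphism of C*-algebras of functions \<open>A\<close> (on \<open>D\<close>) and \<open>B\<close> (on \<open>E\<close>): a bijective
  \<open>*\<close>-homomorphism (these are automatically isometric).\<close>

definition star_isomorphic ::
    "'a set \<Rightarrow> ('a \<Rightarrow> complex) set \<Rightarrow> 'b set \<Rightarrow> ('b \<Rightarrow> complex) set \<Rightarrow> bool" where
  "star_isomorphic D A E B \<longleftrightarrow>
     (\<exists>\<Phi>. bij_betw \<Phi> A B \<and>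
          (\<forall>f\<in>A. \<forall>g\<in>A. \<Phi> (fun_add D f g) = fun_add E (\<Phi> f) (\<Phi> g)) \<and>
          (\<forall>f\<in>A. \<forall>g\<in>A. \<Phi> (fun_mult D f g) = fun_mult E (\<Phi> f) (\<Phi> g)) \<and>
          (\<forall>c. \<forall>f\<in>A. \<Phi> (fun_scale D c f) = fun_scale E c (\<Phi> f)) \<and>
          (\<forall>f\<in>A. \<Phi> (fun_cnj D f) = fun_cnj E (\<Phi> f)))"

text \<open>Characters are the nonzero multiplicative linear functionals; \<open>char_space\<close> carries the
  weak-* topology, i.e. that of pointwise convergence on the algebra.\<close>

definition characters :: "'a set \<Rightarrow> ('a \<Rightarrow> complex) set \<Rightarrow> (('a \<Rightarrow> complex) \<Rightarrow> complex) set" where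
  "characters D A = {\<phi> \<in> extensional A.
     (\<forall>f\<in>A. \<forall>g\<in>A. \<phi> (fun_add D f g) = \<phi> f + \<phi> g) \<and>
     (\<forall>f\<in>A. \<forall>g\<in>A. \<phi> (fun_mult D f g) = \<phi> f * \<phi> g) \<and>
     (\<forall>c. \<forall>f\<in>A. \<phi> (fun_scale D c f) = c * \<phi> f) \<and>
     (\<exists>f\<in>A. \<phi> f \<noteq> 0)}"

definition char_space :: "'a set \<Rightarrow> ('a \<Rightarrow> complex) set \<Rightarrow> (('a \<Rightarrow> complex) \<Rightarrow> complex) topology" where
  "char_space D A = subtopology (product_topology (\<lambda>_. euclidean) A) (characters D A)"

section \<open>The Stone--Cech compactification\<close>

text \<open>\<open>(B, e)\<close> is a Hausdorff compactification of \<open>X\<close> to which every bounded continuous complex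
  function extends; this determines \<open>(B, e)\<close> up to a unique homeomorphism under \<open>X\<close>.\<close>

definition stone_cech :: "'a topology \<Rightarrow> 'b topology \<Rightarrow> ('a \<Rightarrow> 'b) \<Rightarrow> bool" where
  "stone_cech X B e \<longleftrightarrow>
     compact_space B \<and> Hausdorff_space B \<and>
     embedding_map X B e \<and> B closure_of (e ` topspace X) = topspace B \<and>
     (\<forall>f\<in>Cb X. \<exists>g. continuous_map B euclidean g \<and> (\<forall>x\<in>topspace X. g (e x) = f x))"

text \<open>The continuous extension $\widehat{f}$ of \<open>f\<close> to \<open>B\<close>. It is unique because the
  image of \<open>X\<close> is dense and functions in \<open>Cb B\<close> are extensional.\<close>

definition sc_ext :: "'a topology \<Rightarrow> 'b topology \<Rightarrow> ('a \<Rightarrow> 'b) \<Rightarrow> ('a \<Rightarrow> complex) \<Rightarrow> 'b \<Rightarrow> complex" where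
  "sc_ext X B e f = (THE g. g \<in> Cb B \<and> (\<forall>x\<in>topspace X. g (e x) = f x))"

text \<open>The functional $f \mapsto \widehat{f}(p)$ on a subalgebra \<open>A\<close> of \<open>Cb X\<close>. For
  \<open>A = Cb X\<close> it is the character with which \<open>p\<close> is identified.\<close>

definition point_char ::
    "'a topology \<Rightarrow> 'b topology \<Rightarrow> ('a \<Rightarrow> 'b) \<Rightarrow> ('a \<Rightarrow> complex) set \<Rightarrow> 'b \<Rightarrow> ('a \<Rightarrow> complex) \<Rightarrow> complex"
  where
  "point_char X B e A p = (\<lambda>f\<in>A. sc_ext X B e f p)"

text \<open>$K_{\Lambda,\alpha}$ as a subset of $\beta\Lambda$: the points whose character does not vanish
  identically on the ideal $C_{b,\alpha}(\Lambda)$. The space of characters of that ideal is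
  \<open>char_space \<Lambda> (Cb_supp \<Lambda> \<alpha>)\<close>; the two are identified by
  restricting characters, i.e. by \<open>point_char\<close>.\<close>

definition K_subset :: "'a set \<Rightarrow> 'c rel \<Rightarrow> 'b topology \<Rightarrow> ('a \<Rightarrow> 'b) \<Rightarrow> 'b set" where
  "K_subset \<Lambda> \<alpha> B e = {p \<in> topspace B.
     \<exists>f\<in>Cb_supp \<Lambda> \<alpha>. point_char (discrete_topology \<Lambda>) B e (Cb (discrete_topology \<Lambda>)) p f \<noteq> 0}"

text \<open>$\beta S$ for $S \subseteq \Lambda$, as a subset of $\beta\Lambda$.\<close>

definition beta_sub :: "'b topology \<Rightarrow> ('a \<Rightarrow> 'b) \<Rightarrow> 'a set \<Rightarrow> 'b set" where
  "beta_sub B e S = B closure_of (e ` S)"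

text \<open>Existence: a Stone--Cech compactification of a discrete space is the closure of the
  evaluation functionals in the space of functionals on \<open>Cb\<close>.\<close>

lemma stone_cech_exists:
  fixes \<Lambda> :: "'a set"
  shows "\<exists>(B :: (('a \<Rightarrow> complex) \<Rightarrow> complex) topology) e. stone_cech (discrete_topology \<Lambda>) B e"
proof -
  define A where "A = Cb (discrete_topology \<Lambda>)"
  define P :: "(('a \<Rightarrow> complex) \<Rightarrow> complex) topology"
    where "P = product_topology (\<lambda>_. euclidean) A"
  define e where "e = (\<lambda>t. \<lambda>f\<in>A. (f t :: complex))"
  define Z where "Z = P closure_of (e ` \<Lambda>)"
  define B where "B = subtopology P Z"
  have topP: "topspace P = extensional A"
    by (auto simp: P_def PiE_def)
  have eP: "e ` \<Lambda> \<subseteq> topspace P" by (auto simp: topP e_def)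
  have eZ: "e ` \<Lambda> \<subseteq> Z" unfolding Z_def using closure_of_subset[OF eP] .
  have ZP: "Z \<subseteq> topspace P" by (simp add: Z_def closure_of_subset_topspace)
  have hausP: "Hausdorff_space P"
    unfolding P_def by (simp add: Hausdorff_space_product_topology)
  have topB: "topspace B = Z" using ZP by (auto simp: B_def)
  have "\<forall>f\<in>A. \<exists>M. \<forall>t\<in>\<Lambda>. cmod (f t) \<le> M"
    by (auto simp: A_def Cb_def bounded_iff)
  then obtain M where M: "\<And>f t. f \<in> A \<Longrightarrow> t \<in> \<Lambda> \<Longrightarrow> cmod (f t) \<le> M f"
    by metis
  define C :: "(('a \<Rightarrow> complex) \<Rightarrow> complex) set"
    where "C = PiE A (\<lambda>f. cball 0 (M f))"
  have "compactin P C"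
    unfolding P_def C_def by (simp add: compactin_PiE)
  moreover have "e ` \<Lambda> \<subseteq> C" by (auto simp: C_def e_def M)
  ultimately have "compactin P Z"
    unfolding Z_def
    by (meson closed_compactin closedin_closure_of closure_of_minimal compactin_imp_closedin hausP)
  then have comp: "compact_space B"
    by (simp add: B_def compact_space_subtopology)
  have haus: "Hausdorff_space B"
    by (simp add: B_def Hausdorff_space_subtopology hausP)
  have proj: "continuous_map B euclidean (\<lambda>\<phi>. \<phi> f)" if "f \<in> A" for f
    unfolding B_def P_def
    by (rule continuous_map_from_subtopology, rule continuous_map_product_projection[OF that])
  define \<delta> where "\<delta> = (\<lambda>s. \<lambda>t\<in>\<Lambda>. if t = s then (1::complex) else 0)"
  have \<delta>A: "\<delta> s \<in> A" for s
    unfolding A_def Cb_def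
    by (auto simp: \<delta>_def bounded_iff intro!: exI[of _ 1])
  have e\<delta>: "e t (\<delta> s) = (if t = s then 1 else 0)" if "t \<in> \<Lambda>" for s t
    using that \<delta>A by (simp add: e_def \<delta>_def)
  have inj: "inj_on e \<Lambda>"
    by (rule inj_onI) (metis e\<delta> zero_neq_one)
  have disc: "subtopology B (e ` \<Lambda>) = discrete_topology (e ` \<Lambda>)"
  proof -
    have "openin (subtopology B (e ` \<Lambda>)) {e s}" if s: "s \<in> \<Lambda>" for s
    proof -
      have "openin B {\<phi> \<in> topspace B. \<phi> (\<delta> s) \<in> - {0}}"
        by (rule openin_continuous_map_preimage[OF proj[OF \<delta>A]]) (simp add: open_Compl)
      moreover have "{e s} = {\<phi> \<in> topspace B. \<phi> (\<delta> s) \<in> - {0}} \<inter> e ` \<Lambda>"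
        using s eZ by (auto simp: topB e\<delta> split: if_splits)
      ultimately show ?thesis by (auto simp: openin_subtopology)
    qed
    then have "discrete_topology (e ` \<Lambda>) = subtopology B (e ` \<Lambda>)"
      using eZ by (subst discrete_topology_unique) (auto simp: topB)
    then show ?thesis by simp
  qed
  have emb: "embedding_map (discrete_topology \<Lambda>) B e"
    unfolding embedding_map_def topspace_discrete_topology disc
    using inj by (auto simp: homeomorphic_eq_everything_map open_map_def closed_map_def)
  have dense: "B closure_of (e ` \<Lambda>) = topspace B"
    using eZ ZP by (simp add: B_def closure_of_subtopology Int_absorb1 Z_def[symmetric] topB[unfolded B_def])
  have "stone_cech (discrete_topology \<Lambda>) B e"
    unfolding stone_cech_def topspace_discrete_topology
  proof (intro conjI ballI comp haus emb dense)
    fix f assume "f \<in> Cb (discrete_topology \<Lambda>)"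
    then have fA: "f \<in> A" by (simp add: A_def)
    show "\<exists>g. continuous_map B euclidean g \<and> (\<forall>x\<in>\<Lambda>. g (e x) = f x)"
      using proj[OF fA] fA by (intro exI[of _ "\<lambda>\<phi>. \<phi> f"]) (simp add: e_def)
  qed
  then show ?thesis by blast
qed

end

theory Submission
  imports Defs "HOL-Library.Countable_Set_Type"
begin

text \<open>
  Everything is reduced to indicator functions. The extension to $\beta\Lambda$ of the indicator of
  \<open>S\<close> is the indicator of $\beta S$ (lemma \<open>ext_ind\<close>), so each $\beta S$ is clopen,
  and with \<open>U\<close> the union of the $\beta S$ over the small sets \<open>S\<close>, those of cardinality
  at most \<open>\<alpha>\<close>, \<open>U\<close> is open. Call \<open>A\<close> the ideal $C_{b,\alpha}(\Lambda)$.

  The equality with $K_{\Lambda,\alpha}$: the indicator of a small \<open>S\<close> lies in \<open>A\<close> and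
  is 1 on $\beta S$. Conversely \<open>f \<in> A\<close> is its own product with the indicator of its
  support \<open>S\<close>, so its extension vanishes off $\beta S$.

  The homeomorphism: a point of \<open>U\<close> gives a character of \<open>A\<close> by evaluation.
  Injectivity is the Hausdorff property, used to split a small set into two parts with separate
  closures. For surjectivity (\<open>character_is_pc\<close>), a character \<open>\<phi>\<close> takes only the
  values 0 and 1 on indicators, and it is 1 on some small \<open>S\<close>; the subsets of \<open>S\<close> on
  whose indicator it is 1 form an ultrafilter, whose limit \<open>p \<in> \<beta> S\<close> exists by
  compactness. Every \<open>f \<in> A\<close> is close to the value at \<open>p\<close> of its extension on a set
  of this ultrafilter, and an invertibility argument (\<open>character_eq_if_close\<close>) turns this into
  equality of that value with \<open>\<phi> f\<close>. Evaluation is an open map because the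
  $\beta T$ with \<open>T\<close> small form a basis of \<open>U\<close>, and the characters coming from
  $\beta T$ are those that do not vanish at the indicator of \<open>T\<close>.

  The isomorphism with \<open>C0\<close> is extension followed by restriction to \<open>U\<close>. Its
  surjectivity rests on two countability facts: a compact subset of \<open>U\<close> lies in a single
  $\beta S$, because a finite union of small sets is small, and the set where a function vanishing at
  infinity is nonzero is a countable union of compact sets. So the restriction of such a function to
  \<open>\<Lambda>\<close> has small support (\<open>C0_small_support\<close>), and its extension is the
  original function by density.
\<close>

section \<open>Bounded continuous functions and their extensions\<close>

lemma CbD:
  assumes "f \<in> Cb X"
  shows "continuous_map X euclidean f" "bounded (f ` topspace X)"
  using assms by (auto simp: Cb_def)

lemma Cb_discrete_iff:
  "f \<in> Cb (discrete_topology \<Lambda>) \<longleftrightarrow> f \<in> extensional \<Lambda> \<and> bounded (f ` \<Lambda>)"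
  by (auto simp: Cb_def)

lemma continuous_map_mult_complex:
  fixes f g :: "'x \<Rightarrow> complex"
  assumes "continuous_map X euclidean f" "continuous_map X euclidean g"
  shows "continuous_map X euclidean (\<lambda>x. f x * g x)"
  using assms by (simp add: continuous_map_atin tendsto_mult)

lemma continuous_map_cnj:
  assumes "continuous_map X euclidean f"
  shows "continuous_map X euclidean (\<lambda>x. cnj (f x))"
  using assms by (simp add: continuous_map_atin tendsto_cnj)

lemma Cb_fun_add:
  assumes "f \<in> Cb X" "g \<in> Cb X"
  shows "fun_add (topspace X) f g \<in> Cb X"
proof -
  have "continuous_map X euclidean (\<lambda>x. f x + g x)"
    by (intro continuous_map_add CbD assms)
  then have "continuous_map X euclidean (fun_add (topspace X) f g)"
    by (rule continuous_map_eq) (simp add: fun_add_def)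
  moreover have "bounded (fun_add (topspace X) f g ` topspace X)"
    using bounded_plus_comp[OF CbD(2)[OF assms(1)] CbD(2)[OF assms(2)]]
    by (simp add: fun_add_def)
  ultimately show ?thesis by (simp add: Cb_def fun_add_def)
qed

lemma Cb_fun_mult:
  assumes "f \<in> Cb X" "g \<in> Cb X"
  shows "fun_mult (topspace X) f g \<in> Cb X"
proof -
  have "continuous_map X euclidean (\<lambda>x. f x * g x)"
    by (intro continuous_map_mult_complex CbD assms)
  then have "continuous_map X euclidean (fun_mult (topspace X) f g)"
    by (rule continuous_map_eq) (simp add: fun_mult_def)
  moreover obtain M N where "\<And>x. x \<in> topspace X \<Longrightarrow> cmod (f x) \<le> M"
      "\<And>x. x \<in> topspace X \<Longrightarrow> cmod (g x) \<le> N"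
    using CbD(2)[OF assms(1)] CbD(2)[OF assms(2)] by (auto simp: bounded_iff)
  then have "bounded (fun_mult (topspace X) f g ` topspace X)"
    unfolding bounded_iff
    by (intro exI[of _ "M * N"]) (auto simp: fun_mult_def norm_mult intro!: mult_mono' )
  ultimately show ?thesis by (simp add: Cb_def fun_mult_def)
qed

lemma Cb_fun_scale:
  assumes "f \<in> Cb X"
  shows "fun_scale (topspace X) c f \<in> Cb X"
proof -
  have "(\<lambda>x\<in>topspace X. c) \<in> Cb X"
    by (auto simp: Cb_def bounded_iff intro: continuous_map_eq[of _ _ "\<lambda>_. c"])
  from Cb_fun_mult[OF this assms] show ?thesis
    by (simp add: fun_mult_def fun_scale_def cong: restrict_cong)
qed

lemma Cb_fun_cnj:
  assumes "f \<in> Cb X"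
  shows "fun_cnj (topspace X) f \<in> Cb X"
proof -
  have "continuous_map X euclidean (\<lambda>x. cnj (f x))"
    by (intro continuous_map_cnj CbD assms)
  then have "continuous_map X euclidean (fun_cnj (topspace X) f)"
    by (rule continuous_map_eq) (simp add: fun_cnj_def)
  moreover have "bounded (fun_cnj (topspace X) f ` topspace X)"
    using CbD(2)[OF assms] by (auto simp: bounded_iff fun_cnj_def)
  ultimately show ?thesis by (simp add: Cb_def fun_cnj_def)
qed

locale stone_cech_compactification =
  fixes X :: "'a topology" and B :: "'b topology" and e :: "'a \<Rightarrow> 'b"
  assumes stone_cech: "stone_cech X B e"
begin

abbreviation ext :: "('a \<Rightarrow> complex) \<Rightarrow> 'b \<Rightarrow> complex" where
  "ext \<equiv> sc_ext X B e"

lemma compact: "compact_space B"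
  and Hausdorff: "Hausdorff_space B"
  and dense_image: "B closure_of (e ` topspace X) = topspace B"
  and embedding: "embedding_map X B e"
  using stone_cech by (auto simp: stone_cech_def)

lemma embedding_in: "x \<in> topspace X \<Longrightarrow> e x \<in> topspace B"
  using embedding homeomorphic_imp_surjective_map[of X "subtopology B (e ` topspace X)" e]
  by (auto simp: embedding_map_def)

text \<open>All identities between extensions are checked on the dense image of the space.\<close>

lemma eq_on_dense:
  assumes "continuous_map B euclidean f" "continuous_map B euclidean g"
    and "\<And>x. x \<in> topspace X \<Longrightarrow> f (e x) = (g (e x) :: complex)" and "p \<in> topspace B"
  shows "f p = g p"
  by (rule forall_in_closure_of_eq[of p B "e ` topspace X" euclidean])
    (use assms dense_image in auto)

lemma ext_unique:
  assumes "f \<in> Cb X"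
  shows "\<exists>!g. g \<in> Cb B \<and> (\<forall>x\<in>topspace X. g (e x) = f x)"
proof -
  obtain h where h: "continuous_map B euclidean h" "\<And>x. x \<in> topspace X \<Longrightarrow> h (e x) = f x"
    using stone_cech assms by (auto simp: stone_cech_def)
  have "compactin euclidean (h ` topspace B)"
    using compact h(1) unfolding compact_space_def by (rule image_compactin)
  then have "bounded (h ` topspace B)"
    by (simp add: compact_imp_bounded)
  moreover have "continuous_map B euclidean (restrict h (topspace B))"
    using h(1) by (rule continuous_map_eq) simp
  ultimately have "restrict h (topspace B) \<in> Cb B"
    by (simp add: Cb_def)
  then show ?thesis
  proof (intro ex_ex1I exI[of _ "restrict h (topspace B)"])
    fix g g' assume g: "g \<in> Cb B \<and> (\<forall>x\<in>topspace X. g (e x) = f x)"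
      and g': "g' \<in> Cb B \<and> (\<forall>x\<in>topspace X. g' (e x) = f x)"
    show "g = g'"
    proof (rule extensionalityI[of _ "topspace B"])
      show "g p = g' p" if "p \<in> topspace B" for p
        by (rule eq_on_dense[of g g' p]) (use g g' that in \<open>auto simp: Cb_def\<close>)
    qed (use g g' in \<open>auto simp: Cb_def\<close>)
  qed (use h embedding_in in auto)
qed

lemma ext_Cb: "f \<in> Cb X \<Longrightarrow> ext f \<in> Cb B"
  and ext_embedding: "f \<in> Cb X \<Longrightarrow> x \<in> topspace X \<Longrightarrow> ext f (e x) = f x"
  using theI'[OF ext_unique] unfolding sc_ext_def by auto

lemma ext_continuous: "f \<in> Cb X \<Longrightarrow> continuous_map B euclidean (ext f)"
  using ext_Cb CbD(1) by blast

lemma ext_eqI: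
  assumes "f \<in> Cb X" "continuous_map B euclidean h"
    and "\<And>x. x \<in> topspace X \<Longrightarrow> h (e x) = f x" and "p \<in> topspace B"
  shows "ext f p = h p"
  by (rule eq_on_dense[of "ext f" h p]) (use assms in \<open>auto simp: ext_continuous ext_embedding\<close>)

lemma ext_add:
  assumes "f \<in> Cb X" "g \<in> Cb X" "p \<in> topspace B"
  shows "ext (fun_add (topspace X) f g) p = ext f p + ext g p"
  by (rule ext_eqI[OF Cb_fun_add[OF assms(1,2)]])
    (use assms in \<open>auto simp: ext_embedding fun_add_def
                       intro!: continuous_map_add ext_continuous\<close>)

lemma ext_mult:
  assumes "f \<in> Cb X" "g \<in> Cb X" "p \<in> topspace B"
  shows "ext (fun_mult (topspace X) f g) p = ext f p * ext g p"
  by (rule ext_eqI[OF Cb_fun_mult[OF assms(1,2)]])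
    (use assms in \<open>auto simp: ext_embedding fun_mult_def
                       intro!: continuous_map_mult_complex ext_continuous\<close>)

lemma ext_scale:
  assumes "f \<in> Cb X" "p \<in> topspace B"
  shows "ext (fun_scale (topspace X) c f) p = c * ext f p"
  by (rule ext_eqI[OF Cb_fun_scale[OF assms(1)]])
    (use assms in \<open>auto simp: ext_embedding fun_scale_def
                       intro!: continuous_map_mult_complex ext_continuous\<close>)

lemma ext_cnj:
  assumes "f \<in> Cb X" "p \<in> topspace B"
  shows "ext (fun_cnj (topspace X) f) p = cnj (ext f p)"
  by (rule ext_eqI[OF Cb_fun_cnj[OF assms(1)]])
    (use assms in \<open>auto simp: ext_embedding fun_cnj_def
                       intro!: continuous_map_cnj ext_continuous\<close>)

end

section \<open>Clopen sets of the Stone--Cech compactification of a discrete space\<close>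

definition ind :: "'a set \<Rightarrow> 'a set \<Rightarrow> 'a \<Rightarrow> complex" where
  "ind \<Lambda> S = (\<lambda>t\<in>\<Lambda>. of_bool (t \<in> S))"

lemma ind_Cb: "ind \<Lambda> S \<in> Cb (discrete_topology \<Lambda>)"
  by (auto simp: Cb_discrete_iff ind_def bounded_iff intro!: exI[of _ 1])

lemma ind_mult: "fun_mult \<Lambda> (ind \<Lambda> S) (ind \<Lambda> T) = ind \<Lambda> (S \<inter> T)"
  by (auto simp: fun_mult_def ind_def)

lemma mult_ind_support:
  assumes "f \<in> extensional \<Lambda>"
  shows "fun_mult \<Lambda> f (ind \<Lambda> {t \<in> \<Lambda>. f t \<noteq> 0}) = f"
  by (rule extensionalityI[of _ \<Lambda>]) (use assms in \<open>auto simp: fun_mult_def ind_def\<close>)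

locale discrete_stone_cech = stone_cech_compactification "discrete_topology \<Lambda>" B e
  for \<Lambda> :: "'a set" and B :: "'b topology" and e :: "'a \<Rightarrow> 'b"
begin

abbreviation \<beta> :: "'a set \<Rightarrow> 'b set" where
  "\<beta> \<equiv> beta_sub B e"

lemmas ext_simps = ext_add[simplified] ext_mult[simplified] ext_scale[simplified]
  ext_cnj[simplified]

lemma beta_mono: "S \<subseteq> T \<Longrightarrow> \<beta> S \<subseteq> \<beta> T"
  unfolding beta_sub_def by (intro closure_of_mono image_mono)

lemma beta_subset: "\<beta> S \<subseteq> topspace B"
  unfolding beta_sub_def by (rule closure_of_subset_topspace)

lemma embedding_in_beta: "t \<in> S \<Longrightarrow> S \<subseteq> \<Lambda> \<Longrightarrow> e t \<in> \<beta> S"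
  unfolding beta_sub_def
  using closure_of_subset[of "e ` S" B] embedding_in by fastforce

text \<open>The closures of the images of \<open>S\<close> and of its complement cover $\beta\Lambda$, and the
  extension is constant on each of them, with values 1 and 0.\<close>

lemma ext_ind:
  assumes S: "S \<subseteq> \<Lambda>" and p: "p \<in> topspace B"
  shows "ext (ind \<Lambda> S) p = of_bool (p \<in> \<beta> S)"
proof -
  have const: "ext (ind \<Lambda> S) p = c"
    if "p \<in> \<beta> T" "T \<subseteq> \<Lambda>" "\<And>t. t \<in> T \<Longrightarrow> ind \<Lambda> S t = c" for T c
    by (rule forall_in_closure_of_eq[of p B "e ` T" euclidean _ "\<lambda>_. c"])
      (use that in \<open>auto simp: beta_sub_def ext_continuous ind_Cb ext_embedding subset_iff\<close>)
  have one: "ext (ind \<Lambda> S) p = 1" if "p \<in> \<beta> S"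
    by (rule const[OF that S]) (use S in \<open>auto simp: ind_def\<close>)
  have zero: "ext (ind \<Lambda> S) p = 0" if "p \<in> \<beta> (\<Lambda> - S)"
    by (rule const[OF that]) (auto simp: ind_def)
  have "p \<in> \<beta> S \<union> \<beta> (\<Lambda> - S)"
  proof -
    have "e ` S \<union> e ` (\<Lambda> - S) = e ` \<Lambda>" using S by auto
    then show ?thesis
      using p dense_image unfolding beta_sub_def by (metis closure_of_Un topspace_discrete_topology)
  qed
  with one zero show ?thesis by auto
qed

lemma closedin_beta: "closedin B (\<beta> S)"
  by (simp add: beta_sub_def)

lemma openin_beta:
  assumes "S \<subseteq> \<Lambda>"
  shows "openin B (\<beta> S)"
proof -
  have "openin B {p \<in> topspace B. ext (ind \<Lambda> S) p \<in> - {0}}"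
    by (rule openin_continuous_map_preimage[OF ext_continuous[OF ind_Cb]]) (simp add: open_Compl)
  moreover have "{p \<in> topspace B. ext (ind \<Lambda> S) p \<in> - {0}} = \<beta> S"
    using assms beta_subset[of S] by (auto simp: ext_ind subset_iff)
  ultimately show ?thesis by simp
qed

text \<open>The product of the two indicators is the zero function, so their extensions cannot both be 1.\<close>

lemma beta_disjoint:
  assumes "S \<subseteq> \<Lambda>" "T \<subseteq> \<Lambda>" "S \<inter> T = {}"
  shows "\<beta> S \<inter> \<beta> T = {}"
proof -
  have "S \<subseteq> \<Lambda> - T" using assms by blast
  have False if p: "p \<in> \<beta> S" "p \<in> \<beta> T" for p
  proof -
    have "p \<in> topspace B" using p beta_subset by blast
    then have "ext (fun_mult \<Lambda> (ind \<Lambda> S) (ind \<Lambda> T)) p = 1"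
      using p assms by (simp add: ext_simps ind_Cb ext_ind)
    moreover have "ext (ind \<Lambda> {}) p = 0"
      using \<open>p \<in> topspace B\<close> by (simp add: ext_ind) (simp add: beta_sub_def)
    ultimately show False using assms by (simp add: ind_mult)
  qed
  then show ?thesis by blast
qed

lemma embedding_in_beta_iff:
  assumes "t \<in> \<Lambda>" "S \<subseteq> \<Lambda>"
  shows "e t \<in> \<beta> S \<longleftrightarrow> t \<in> S"
  using ext_ind[OF assms(2) embedding_in, of t] ext_embedding[OF ind_Cb[of \<Lambda> S], of t] assms
  by (simp add: ind_def of_bool_eq_iff split: if_splits)

text \<open>Traces of open neighbourhoods cut a set down without losing a given limit point; this is the
  source of all small sets with a prescribed position in $\beta\Lambda$.\<close>

lemma beta_Int_open:
  assumes "openin B V" "p \<in> \<beta> S" "p \<in> V"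
  shows "p \<in> \<beta> {t \<in> S. e t \<in> V}"
proof -
  have "p \<in> B closure_of (V \<inter> e ` S)"
    using openin_Int_closure_of_subset[OF assms(1)] assms by (auto simp: beta_sub_def)
  moreover have "V \<inter> e ` S = e ` {t \<in> S. e t \<in> V}" by auto
  ultimately show ?thesis by (simp add: beta_sub_def)
qed

text \<open>Multiplying \<open>f\<close> by the indicator of its support changes nothing, and this identity passes
  to the extensions.\<close>

lemma ext_nonzero_imp_beta_support:
  assumes f: "f \<in> Cb (discrete_topology \<Lambda>)" and p: "p \<in> topspace B" and "ext f p \<noteq> 0"
  shows "p \<in> \<beta> {t \<in> \<Lambda>. f t \<noteq> 0}"
proof -
  let ?S = "{t \<in> \<Lambda>. f t \<noteq> 0}"
  have "fun_mult \<Lambda> f (ind \<Lambda> ?S) = f"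
    using f by (intro mult_ind_support) (simp add: Cb_discrete_iff)
  then have "ext f p = ext f p * ext (ind \<Lambda> ?S) p"
    using ext_simps(2)[OF f ind_Cb p, of ?S] by simp
  then have "ext (ind \<Lambda> ?S) p \<noteq> 0"
    using assms(3) by auto
  then show ?thesis
    using p by (simp add: ext_ind split: if_splits)
qed

end

section \<open>The ideal of functions with small support\<close>

locale small_support = discrete_stone_cech \<Lambda> B e
  for \<Lambda> :: "'a set" and B :: "'b topology" and e :: "'a \<Rightarrow> 'b" +
  fixes \<alpha> :: "'c rel"
  assumes Cinfinite: "Cinfinite \<alpha>"
begin

definition small :: "'a set \<Rightarrow> bool" where
  "small S \<longleftrightarrow> S \<subseteq> \<Lambda> \<and> |S| \<le>o \<alpha>"

abbreviation A :: "('a \<Rightarrow> complex) set" where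
  "A \<equiv> Cb_supp \<Lambda> \<alpha>"

definition U :: "'b set" where
  "U = (\<Union>S\<in>{S. S \<subseteq> \<Lambda> \<and> |S| \<le>o \<alpha>}. \<beta> S)"

lemma U_iff: "p \<in> U \<longleftrightarrow> (\<exists>S. small S \<and> p \<in> \<beta> S)"
  by (auto simp: U_def small_def)

lemma small_subset_carrier: "small S \<Longrightarrow> S \<subseteq> \<Lambda>"
  by (simp add: small_def)

lemma small_mono: "small T \<Longrightarrow> S \<subseteq> T \<Longrightarrow> small S"
  unfolding small_def by (meson card_of_mono1 ordLeq_transitive subset_trans)

lemma small_Un: "small S \<Longrightarrow> small T \<Longrightarrow> small (S \<union> T)"
  using Cinfinite unfolding small_def cinfinite_def
  by (auto intro: card_of_Un_ordLeq_infinite_Field)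

lemma countable_le: "countable I \<Longrightarrow> |I| \<le>o \<alpha>"
  using natLeq_ordLeq_cinfinite[OF Cinfinite] countable_card_le_natLeq ordLeq_transitive by blast

lemma small_UN:
  assumes "countable I" "\<And>i. i \<in> I \<Longrightarrow> small (S i)"
  shows "small (\<Union>i\<in>I. S i)"
  using card_of_UNION_ordLeq_infinite_Field[of \<alpha> I S] countable_le[OF assms(1)] assms(2) Cinfinite
  unfolding small_def cinfinite_def by auto

lemma small_countable: "S \<subseteq> \<Lambda> \<Longrightarrow> countable S \<Longrightarrow> small S"
  by (simp add: small_def countable_le)

lemma A_iff:
  "f \<in> A \<longleftrightarrow> f \<in> Cb (discrete_topology \<Lambda>) \<and> small {t \<in> \<Lambda>. f t \<noteq> 0}"
  by (auto simp: Cb_supp_def small_def)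

lemma A_Cb: "f \<in> A \<Longrightarrow> f \<in> Cb (discrete_topology \<Lambda>)"
  by (simp add: A_iff)

lemma A_I:
  assumes "f \<in> Cb (discrete_topology \<Lambda>)" "small S" "\<And>t. t \<in> \<Lambda> \<Longrightarrow> f t \<noteq> 0 \<Longrightarrow> t \<in> S"
  shows "f \<in> A"
  using assms small_mono[of S "{t \<in> \<Lambda>. f t \<noteq> 0}"] by (auto simp: A_iff)

lemma ind_A: "small S \<Longrightarrow> ind \<Lambda> S \<in> A"
  by (rule A_I[OF ind_Cb, of S]) (auto simp: ind_def)

lemma A_closed:
  assumes "f \<in> A"
  shows "g \<in> A \<Longrightarrow> fun_add \<Lambda> f g \<in> A"
    and "g \<in> Cb (discrete_topology \<Lambda>) \<Longrightarrow> fun_mult \<Lambda> f g \<in> A"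
    and "fun_scale \<Lambda> c f \<in> A"
    and "fun_cnj \<Lambda> f \<in> A"
proof -
  let ?S = "\<lambda>f. {t \<in> \<Lambda>. f t \<noteq> (0::complex)}"
  have f: "f \<in> Cb (discrete_topology \<Lambda>)" "small (?S f)"
    using assms by (auto simp: A_iff)
  show "fun_add \<Lambda> f g \<in> A" if "g \<in> A"
    using that f Cb_fun_add[of f "discrete_topology \<Lambda>" g]
    by (intro A_I[of _ "?S f \<union> ?S g"] small_Un) (auto simp: A_iff fun_add_def)
  show "fun_mult \<Lambda> f g \<in> A" if "g \<in> Cb (discrete_topology \<Lambda>)"
    using that f Cb_fun_mult[of f "discrete_topology \<Lambda>" g]
    by (intro A_I[of _ "?S f"]) (auto simp: fun_mult_def)
  show "fun_scale \<Lambda> c f \<in> A"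
    using f Cb_fun_scale[of f "discrete_topology \<Lambda>" c]
    by (intro A_I[of _ "?S f"]) (auto simp: fun_scale_def)
  show "fun_cnj \<Lambda> f \<in> A"
    using f Cb_fun_cnj[of f "discrete_topology \<Lambda>"]
    by (intro A_I[of _ "?S f"]) (auto simp: fun_cnj_def)
qed

lemma A_ext_nonzero_imp_U:
  assumes "f \<in> A" "p \<in> topspace B" "ext f p \<noteq> 0"
  shows "p \<in> U"
  using ext_nonzero_imp_beta_support[OF A_Cb] assms U_iff A_iff by blast

lemma U_subset: "U \<subseteq> topspace B"
  using beta_subset by (fastforce simp: U_iff)

lemma openin_U: "openin B U"
  unfolding U_def by (intro openin_Union) (auto intro: openin_beta)

lemma embedding_in_U: "t \<in> \<Lambda> \<Longrightarrow> e t \<in> U"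
  unfolding U_iff by (intro exI[of _ "{t}"]) (simp add: small_countable embedding_in_beta)

lemma K_subset_eq: "K_subset \<Lambda> \<alpha> B e = U"
proof
  show "K_subset \<Lambda> \<alpha> B e \<subseteq> U"
    using A_ext_nonzero_imp_U by (auto simp: K_subset_def point_char_def A_Cb)
  show "U \<subseteq> K_subset \<Lambda> \<alpha> B e"
  proof
    fix p assume "p \<in> U"
    then obtain S where S: "small S" "p \<in> \<beta> S" by (auto simp: U_iff)
    then have "p \<in> topspace B" "ext (ind \<Lambda> S) p = 1"
      using beta_subset[of S] by (auto simp: ext_ind small_subset_carrier)
    then show "p \<in> K_subset \<Lambda> \<alpha> B e"
      using ind_A[OF S(1)] ind_Cb
      by (auto simp: K_subset_def point_char_def intro!: bexI[of _ "ind \<Lambda> S"])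
  qed
qed

abbreviation pc :: "'b \<Rightarrow> ('a \<Rightarrow> complex) \<Rightarrow> complex" where
  "pc \<equiv> point_char (discrete_topology \<Lambda>) B e A"

lemma pc_apply: "f \<in> A \<Longrightarrow> pc p f = ext f p"
  by (simp add: point_char_def)

text \<open>The functional does not vanish identically: at a point of $\beta S$ it is 1 on the indicator
  of \<open>S\<close>.\<close>

lemma pc_character:
  assumes "p \<in> U"
  shows "pc p \<in> characters \<Lambda> A"
proof -
  obtain S where S: "small S" "p \<in> \<beta> S" using assms by (auto simp: U_iff)
  have p: "p \<in> topspace B" using assms U_subset by blast
  have "pc p (ind \<Lambda> S) \<noteq> 0"
    using S p by (simp add: pc_apply ind_A ext_ind small_subset_carrier)
  then show ?thesis
    using ind_A[OF S(1)] p
    by (auto simp: characters_def pc_apply A_closed A_Cb ext_simps)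
      (auto simp: point_char_def)
qed

text \<open>If \<open>V\<close> is a neighbourhood of \<open>p\<close> whose closure misses \<open>q\<close>, then the part
  \<open>T\<close> of a small set that \<open>e\<close> maps into \<open>V\<close> has \<open>p\<close> but not
  \<open>q\<close> in its closure, and its indicator separates the two functionals.\<close>

lemma pc_inj: "inj_on pc U"
proof (rule inj_onI, rule ccontr)
  fix p q assume pq: "p \<in> U" "q \<in> U" "pc p = pc q" "p \<noteq> q"
  then obtain V W where VW: "openin B V" "openin B W" "p \<in> V" "q \<in> W" "disjnt V W"
    using Hausdorff U_subset unfolding Hausdorff_space_def by (metis subsetD)
  obtain S where S: "small S" "p \<in> \<beta> S" using pq by (auto simp: U_iff)
  define T where "T = {t \<in> S. e t \<in> V}"
  have T: "small T" using small_mono[OF S(1)] by (auto simp: T_def)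
  have "p \<in> \<beta> T" unfolding T_def by (rule beta_Int_open[OF VW(1) S(2) VW(3)])
  moreover have "q \<notin> \<beta> T"
  proof -
    have "W \<inter> e ` T = {}" using VW(5) by (auto simp: T_def disjnt_iff)
    then have "W \<inter> \<beta> T = {}"
      unfolding beta_sub_def using openin_Int_closure_of_eq_empty[OF VW(2)] by blast
    then show ?thesis using VW(4) by blast
  qed
  moreover have "ext (ind \<Lambda> T) p = ext (ind \<Lambda> T) q"
    using pq(3) pc_apply[OF ind_A[OF T]] by metis
  ultimately show False
    using ext_ind[OF small_subset_carrier[OF T]] pq(1,2) U_subset by (simp add: subset_iff)
qed

lemma character_apply:
  assumes "\<phi> \<in> characters \<Lambda> A" "f \<in> A"
  shows "g \<in> A \<Longrightarrow> \<phi> (fun_add \<Lambda> f g) = \<phi> f + \<phi> g"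
    and "g \<in> A \<Longrightarrow> \<phi> (fun_mult \<Lambda> f g) = \<phi> f * \<phi> g"
    and "\<phi> (fun_scale \<Lambda> c f) = c * \<phi> f"
  using assms by (auto simp: characters_def)

lemma character_ind_Int:
  assumes "\<phi> \<in> characters \<Lambda> A" "small S" "small T"
  shows "\<phi> (ind \<Lambda> (S \<inter> T)) = \<phi> (ind \<Lambda> S) * \<phi> (ind \<Lambda> T)"
  using character_apply(2)[OF assms(1) ind_A ind_A, of S T] assms by (simp add: ind_mult)

lemma character_ind_empty:
  assumes "\<phi> \<in> characters \<Lambda> A"
  shows "\<phi> (ind \<Lambda> {}) = 0"
proof -
  have "fun_scale \<Lambda> 0 (ind \<Lambda> {}) = ind \<Lambda> {}"
    by (auto simp: fun_scale_def ind_def)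
  then show ?thesis
    using character_apply(3)[OF assms ind_A, of "{}" 0] small_countable[of "{}"] by simp
qed

lemma character_ind_Diff:
  assumes "\<phi> \<in> characters \<Lambda> A" "small S" "T \<subseteq> S"
  shows "\<phi> (ind \<Lambda> S) = \<phi> (ind \<Lambda> T) + \<phi> (ind \<Lambda> (S - T))"
proof -
  have "fun_add \<Lambda> (ind \<Lambda> T) (ind \<Lambda> (S - T)) = ind \<Lambda> S"
    using assms(3) by (intro extensionalityI[of _ \<Lambda>]) (auto simp: fun_add_def ind_def)
  moreover have "small T" "small (S - T)"
    using assms small_mono by auto
  ultimately show ?thesis
    using character_apply(1)[OF assms(1) ind_A ind_A, of T "S - T"] by simp
qed

lemma character_ind_cases:
  assumes "\<phi> \<in> characters \<Lambda> A" "small S"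
  shows "\<phi> (ind \<Lambda> S) = 0 \<or> \<phi> (ind \<Lambda> S) = 1"
  using character_ind_Int[OF assms assms(2)] by auto

text \<open>If \<open>d = \<phi> f\<close> differed from \<open>c\<close>, then \<open>f - d\<close> would be bounded away
  from 0 on some \<open>T\<close> whose indicator has value 1 under \<open>\<phi>\<close>. The indicator of
  \<open>T\<close> would then be a multiple of \<open>(f - d)\<close> times itself, which \<open>\<phi>\<close> sends
  to 0.\<close>

lemma character_eq_if_close:
  assumes \<phi>: "\<phi> \<in> characters \<Lambda> A" and f: "f \<in> A"
    and close: "\<And>\<epsilon>. \<epsilon> > 0 \<Longrightarrow>
      \<exists>T. small T \<and> (\<forall>t\<in>T. cmod (f t - c) < \<epsilon>) \<and> \<phi> (ind \<Lambda> T) = 1"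
  shows "\<phi> f = c"
proof (rule ccontr)
  define d where "d = \<phi> f"
  assume "\<phi> f \<noteq> c"
  then have pos: "cmod (d - c) / 2 > 0" by (simp add: d_def)
  obtain T where T: "small T" "\<And>t. t \<in> T \<Longrightarrow> cmod (f t - c) < cmod (d - c) / 2"
      "\<phi> (ind \<Lambda> T) = 1"
    using close[OF pos] by blast
  have far: "cmod (f t - d) \<ge> cmod (d - c) / 2" if "t \<in> T" for t
    using T(2)[OF that] norm_triangle_ineq[of "f t - c" "d - f t"] norm_minus_commute[of d "f t"]
    by auto
  \<comment> \<open>\<open>h\<close> is the inverse of \<open>f - d\<close> on \<open>T\<close>, extended by 0; it is bounded by \<open>far\<close>.\<close>
  define h where "h = (\<lambda>t\<in>\<Lambda>. if t \<in> T then 1 / (f t - d) else 0)"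
  have "cmod (h t) \<le> 2 / cmod (d - c)" if "t \<in> \<Lambda>" for t
  proof (cases "t \<in> T")
    case True
    then have "1 / cmod (f t - d) \<le> 1 / (cmod (d - c) / 2)"
      using far[OF True] pos by (intro divide_left_mono mult_pos_pos) auto
    with True that show ?thesis by (simp add: h_def norm_divide)
  qed (use that pos in \<open>simp add: h_def\<close>)
  then have "bounded (h ` \<Lambda>)"
    unfolding bounded_iff by blast
  then have "h \<in> Cb (discrete_topology \<Lambda>)"
    by (simp add: Cb_discrete_iff h_def)
  then have h: "h \<in> A"
    by (rule A_I[OF _ T(1)]) (auto simp: h_def split: if_splits)
  \<comment> \<open>The algebra has no unit, so \<open>f - d\<close> is replaced by its product with the indicator of \<open>T\<close>.\<close>
  define g where "g = fun_add \<Lambda> (fun_mult \<Lambda> f (ind \<Lambda> T)) (fun_scale \<Lambda> (- d) (ind \<Lambda> T))"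
  have parts: "fun_mult \<Lambda> f (ind \<Lambda> T) \<in> A" "fun_scale \<Lambda> (- d) (ind \<Lambda> T) \<in> A"
    by (rule A_closed(2)[OF f ind_Cb]) (rule A_closed(3)[OF ind_A[OF T(1)]])
  have g: "g \<in> A" unfolding g_def by (intro A_closed parts)
  have "\<phi> g = 0"
    unfolding g_def using T(3) f ind_A[OF T(1)] parts
    by (simp add: character_apply[OF \<phi>] d_def)
  have "fun_mult \<Lambda> h g = ind \<Lambda> T"
  proof (rule extensionalityI[of _ \<Lambda>])
    fix t assume "t \<in> \<Lambda>"
    moreover have "f t - d \<noteq> 0" if "t \<in> T" using far[OF that] pos by auto
    ultimately show "fun_mult \<Lambda> h g t = ind \<Lambda> T t"
      by (auto simp: fun_mult_def fun_add_def fun_scale_def h_def g_def ind_def)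
  qed (auto simp: fun_mult_def ind_def)
  then have "\<phi> (ind \<Lambda> T) = \<phi> h * \<phi> g"
    using character_apply(2)[OF \<phi> h g] by simp
  with \<open>\<phi> g = 0\<close> T(3) show False by simp
qed

text \<open>The sets \<open>T\<close> in question are closed under intersection and nonempty, since \<open>\<phi>\<close>
  vanishes at the zero function. So the clopen sets $\beta T$ have the finite intersection
  property, and compactness gives a common point.\<close>

lemma character_limit_point:
  assumes \<phi>: "\<phi> \<in> characters \<Lambda> A" and S: "small S" "\<phi> (ind \<Lambda> S) = 1"
  obtains p where "\<And>T. T \<subseteq> S \<Longrightarrow> \<phi> (ind \<Lambda> T) = 1 \<Longrightarrow> p \<in> \<beta> T"
proof -
  define \<G> where "\<G> = {T. T \<subseteq> S \<and> \<phi> (ind \<Lambda> T) = 1}"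
  have small: "small T" if "T \<in> \<G>" for T
    using that small_mono[OF S(1)] by (auto simp: \<G>_def)
  have lower: "\<exists>R\<in>\<G>. \<forall>T\<in>\<F>. R \<subseteq> T" if "finite \<F>" "\<F> \<subseteq> \<G>" for \<F>
    using that
  proof (induction \<F>)
    case empty
    then show ?case using S by (auto simp: \<G>_def)
  next
    case (insert T \<F>)
    then obtain R where R: "R \<in> \<G>" "\<forall>T\<in>\<F>. R \<subseteq> T" by auto
    have "\<phi> (ind \<Lambda> (R \<inter> T)) = 1"
      using character_ind_Int[OF \<phi> small small, of R T] R insert by (simp add: \<G>_def)
    then have "R \<inter> T \<in> \<G>" using R by (auto simp: \<G>_def)
    then show ?case using R(2) by (intro bexI[of _ "R \<inter> T"]) auto
  qed
  have "\<Inter>\<F> \<noteq> {}" if F: "finite \<F>" "\<F> \<subseteq> \<beta> ` \<G>" for \<F>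
  proof -
    obtain \<F>' where F': "finite \<F>'" "\<F>' \<subseteq> \<G>" "\<F> = \<beta> ` \<F>'"
      using finite_subset_image[OF F] by blast
    obtain R where R: "R \<in> \<G>" "\<forall>T\<in>\<F>'. R \<subseteq> T"
      using lower[OF F'(1,2)] by blast
    have "R \<noteq> {}"
      using R(1) character_ind_empty[OF \<phi>] by (auto simp: \<G>_def)
    then obtain t where t: "t \<in> R" by auto
    then have "e t \<in> \<beta> R"
      using small[OF R(1)] by (simp add: embedding_in_beta small_subset_carrier)
    then have "e t \<in> \<beta> T" if "T \<in> \<F>'" for T
      using beta_mono R(2) that by blast
    then have "e t \<in> \<Inter>\<F>" by (auto simp: F'(3))
    then show ?thesis by blast
  qed
  moreover have "\<forall>C\<in>\<beta> ` \<G>. closedin B C" by (auto simp: closedin_beta)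
  ultimately have "\<Inter>(\<beta> ` \<G>) \<noteq> {}"
    using compact[unfolded compact_space_fip, rule_format, of "\<beta> ` \<G>"] by simp
  then obtain p where "p \<in> \<Inter>(\<beta> ` \<G>)" by blast
  then show ?thesis by (intro that[of p]) (auto simp: \<G>_def)
qed

text \<open>The limit \<open>p\<close> of the ultrafilter of \<open>\<phi>\<close> is the point sought. Near \<open>p\<close>
  the extension of \<open>f\<close> is almost constant, and the set \<open>T\<close> of those \<open>t\<close> in
  \<open>S\<close> that land near \<open>p\<close> belongs to the ultrafilter: otherwise \<open>S - T\<close> would,
  and \<open>p\<close> would be in the closure of both.\<close>

lemma character_is_pc:
  assumes \<phi>: "\<phi> \<in> characters \<Lambda> A"
  obtains p where "p \<in> U" "\<phi> = pc p"
proof -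
  obtain f0 where f0: "f0 \<in> A" "\<phi> f0 \<noteq> 0" using \<phi> by (auto simp: characters_def)
  \<comment> \<open>The support of \<open>f0\<close> belongs to the ultrafilter, since \<open>f0\<close> is its own product with the indicator of \<open>S\<close>.\<close>
  define S where "S = {t \<in> \<Lambda>. f0 t \<noteq> 0}"
  have S: "small S" using f0(1) by (simp add: A_iff S_def)
  have "fun_mult \<Lambda> f0 (ind \<Lambda> S) = f0"
    unfolding S_def using A_Cb[OF f0(1)] by (intro mult_ind_support) (simp add: Cb_discrete_iff)
  then have "\<phi> f0 = \<phi> f0 * \<phi> (ind \<Lambda> S)"
    using character_apply(2)[OF \<phi> f0(1) ind_A[OF S]] by simp
  then have S1: "\<phi> (ind \<Lambda> S) = 1" using f0(2) by simp
  obtain p where p: "\<And>T. T \<subseteq> S \<Longrightarrow> \<phi> (ind \<Lambda> T) = 1 \<Longrightarrow> p \<in> \<beta> T"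
    using character_limit_point[OF \<phi> S S1] by blast
  have pS: "p \<in> \<beta> S" by (rule p) (use S1 in auto)
  have pB: "p \<in> topspace B" using pS beta_subset by blast
  have "\<phi> f = ext f p" if f: "f \<in> A" for f
  proof (rule character_eq_if_close[OF \<phi> f])
    fix \<epsilon> :: real assume "\<epsilon> > 0"
    define V where "V = {q \<in> topspace B. ext f q \<in> ball (ext f p) \<epsilon>}"
    have "openin B V"
      unfolding V_def by (rule openin_continuous_map_preimage[OF ext_continuous[OF A_Cb[OF f]]]) simp
    moreover have "p \<in> V" using pB \<open>\<epsilon> > 0\<close> by (simp add: V_def)
    ultimately have pT: "p \<in> \<beta> {t \<in> S. e t \<in> V}"
      using beta_Int_open pS by blast
    define T where "T = {t \<in> S. e t \<in> V}"
    have T: "T \<subseteq> S" "small T" "small (S - T)" "p \<in> \<beta> T"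
      using small_mono[OF S] pT by (auto simp: T_def)
    have "cmod (f t - ext f p) < \<epsilon>" if "t \<in> T" for t
      using that small_subset_carrier[OF S] ext_embedding[OF A_Cb[OF f], of t]
      by (auto simp: T_def V_def dist_norm norm_minus_commute subset_iff)
    moreover have "\<phi> (ind \<Lambda> T) = 1"
    proof (rule ccontr)
      assume "\<phi> (ind \<Lambda> T) \<noteq> 1"
      then have "\<phi> (ind \<Lambda> (S - T)) = 1"
        using character_ind_cases[OF \<phi> T(2)] character_ind_Diff[OF \<phi> S T(1)] S1 by auto
      then have "p \<in> \<beta> (S - T)" by (intro p) auto
      then show False
        using T beta_disjoint[of T "S - T"] by (auto simp: small_subset_carrier)
    qed
    ultimately show "\<exists>T. small T \<and> (\<forall>t\<in>T. cmod (f t - ext f p) < \<epsilon>) \<and> \<phi> (ind \<Lambda> T) = 1"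
      using T(2) by blast
  qed
  then have "\<phi> = pc p"
    using \<phi> by (intro extensionalityI[of _ A]) (auto simp: characters_def point_char_def)
  moreover have "p \<in> U" using pS S by (auto simp: U_iff)
  ultimately show ?thesis using that by blast
qed

lemma pc_image: "pc ` U = characters \<Lambda> A"
  using pc_character character_is_pc by blast

lemma topspace_char_space: "topspace (char_space \<Lambda> A) = characters \<Lambda> A"
  by (auto simp: char_space_def characters_def PiE_def)

lemma pc_continuous: "continuous_map (subtopology B U) (char_space \<Lambda> A) pc"
  unfolding char_space_def continuous_map_in_subtopology continuous_map_componentwise
proof (intro conjI ballI)
  fix f assume f: "f \<in> A"
  have "continuous_map (subtopology B U) euclidean (ext f)"
    by (intro continuous_map_from_subtopology ext_continuous A_Cb f)
  then show "continuous_map (subtopology B U) euclidean (\<lambda>p. pc p f)"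
    using f by (simp add: pc_apply)
qed (use pc_character in \<open>auto simp: point_char_def\<close>)

text \<open>By surjectivity, the image consists of all characters that are nonzero at the indicator of
  \<open>T\<close>, which is a weak-* open condition.\<close>

lemma char_space_openin_pc_beta:
  assumes T: "small T"
  shows "openin (char_space \<Lambda> A) (pc ` \<beta> T)"
proof -
  have "continuous_map (char_space \<Lambda> A) euclidean (\<lambda>\<phi>. \<phi> (ind \<Lambda> T))"
    unfolding char_space_def
    by (intro continuous_map_from_subtopology continuous_map_product_projection ind_A T)
  then have "openin (char_space \<Lambda> A) {\<phi> \<in> topspace (char_space \<Lambda> A). \<phi> (ind \<Lambda> T) \<in> - {0}}"
    by (rule openin_continuous_map_preimage) (simp add: open_Compl)
  moreover have "pc ` \<beta> T = {\<phi> \<in> topspace (char_space \<Lambda> A). \<phi> (ind \<Lambda> T) \<in> - {0}}"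
  proof -
    have sub: "\<beta> T \<subseteq> U" using T by (auto simp: U_iff)
    have "p \<in> \<beta> T \<longleftrightarrow> pc p (ind \<Lambda> T) \<noteq> 0" if "p \<in> U" for p
      using ext_ind[OF small_subset_carrier[OF T], of p] that U_subset
      by (auto simp: pc_apply ind_A[OF T])
    then show ?thesis
      unfolding topspace_char_space pc_image[symmetric] using sub by auto
  qed
  ultimately show ?thesis by simp
qed

text \<open>By regularity \<open>p\<close> has a closed neighbourhood inside \<open>V\<close>; the closure of the part of
  a small set lying in it cannot leave \<open>V\<close>.\<close>

lemma beta_basis:
  assumes "openin B V" "p \<in> V" "p \<in> U"
  obtains T where "small T" "p \<in> \<beta> T" "\<beta> T \<subseteq> V"
proof -
  have "neighbourhood_base_of (closedin B) B"
    using compact_Hausdorff_imp_regular_space[OF compact Hausdorff]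
    by (simp add: neighbourhood_base_of_closedin)
  then obtain W C where WC: "openin B W" "closedin B C" "p \<in> W" "W \<subseteq> C" "C \<subseteq> V"
    using assms(1,2) unfolding neighbourhood_base_of by metis
  obtain S where S: "small S" "p \<in> \<beta> S" using assms by (auto simp: U_iff)
  show ?thesis
  proof
    show "small {t \<in> S. e t \<in> W}" using small_mono[OF S(1)] by auto
    show "p \<in> \<beta> {t \<in> S. e t \<in> W}" by (rule beta_Int_open[OF WC(1) S(2) WC(3)])
    have "\<beta> {t \<in> S. e t \<in> W} \<subseteq> C"
      unfolding beta_sub_def by (rule closure_of_minimal) (use WC in auto)
    then show "\<beta> {t \<in> S. e t \<in> W} \<subseteq> V" using WC by auto
  qed
qed

lemma pc_open: "open_map (subtopology B U) (char_space \<Lambda> A) pc"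
  unfolding open_map_def
proof (intro allI impI)
  fix V assume "openin (subtopology B U) V"
  then have V: "openin B V" "V \<subseteq> U"
    by (simp_all add: openin_open_subtopology[OF openin_U])
  show "openin (char_space \<Lambda> A) (pc ` V)"
  proof (subst openin_subopen, intro ballI)
    fix \<phi> assume "\<phi> \<in> pc ` V"
    then obtain p where p: "p \<in> V" "\<phi> = pc p" by auto
    then obtain T where T: "small T" "p \<in> \<beta> T" "\<beta> T \<subseteq> V"
      using beta_basis[OF V(1), of p] V(2) by blast
    then show "\<exists>W. openin (char_space \<Lambda> A) W \<and> \<phi> \<in> W \<and> W \<subseteq> pc ` V"
      using p by (intro exI[of _ "pc ` \<beta> T"]) (auto simp: char_space_openin_pc_beta)
  qed
qed

lemma pc_homeomorphic: "homeomorphic_map (subtopology B U) (char_space \<Lambda> A) pc"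
  using pc_continuous pc_open pc_inj U_subset
  by (intro bijective_open_imp_homeomorphic_map)
    (auto simp: topspace_char_space pc_image[symmetric] Int_absorb1)

section \<open>Functions vanishing at infinity\<close>

lemma topspace_U: "topspace (subtopology B U) = U"
  using U_subset by auto

text \<open>Compactness in \<open>U\<close> is compactness in $\beta\Lambda$, so the conditions can be read there.\<close>

lemma C0_U_iff:
  "g \<in> C0 (subtopology B U) \<longleftrightarrow>
     g \<in> extensional U \<and> continuous_map (subtopology B U) euclidean g \<and>
     (\<forall>\<epsilon>>0. compactin B {p \<in> U. \<epsilon> \<le> cmod (g p)})"
  unfolding C0_def topspace_U compactin_subtopology by auto

text \<open>The extension vanishes off \<open>U\<close>, so the sets where its modulus is at least \<open>\<epsilon>\<close> are
  closed in the compact space $\beta\Lambda$, not merely in \<open>U\<close>.\<close>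

lemma restrict_ext_C0:
  assumes f: "f \<in> A"
  shows "restrict (ext f) U \<in> C0 (subtopology B U)"
proof -
  have cont: "continuous_map B euclidean (ext f)" by (intro ext_continuous A_Cb f)
  have "continuous_map (subtopology B U) euclidean (restrict (ext f) U)"
    by (rule continuous_map_eq[OF continuous_map_from_subtopology[OF cont]]) (simp add: topspace_U)
  moreover have "compactin B {p \<in> U. \<epsilon> \<le> cmod (restrict (ext f) U p)}"
    if "\<epsilon> > 0" for \<epsilon>
  proof -
    have "closedin B {p \<in> topspace B. cmod (ext f p) \<in> {\<epsilon>..}}"
      by (rule closedin_continuous_map_preimage[OF continuous_map_norm[OF cont]]) simp
    moreover have "{p \<in> topspace B. cmod (ext f p) \<in> {\<epsilon>..}} = {p \<in> U. \<epsilon> \<le> cmod (restrict (ext f) U p)}"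
      using A_ext_nonzero_imp_U[OF f] U_subset that by force
    ultimately show ?thesis
      using compact closedin_compact_space by metis
  qed
  ultimately show ?thesis
    unfolding C0_U_iff by blast
qed

text \<open>The open sets $\beta S$ cover \<open>K\<close>; a finite subcover is contained in the closure of the
  union of its index sets.\<close>

lemma compact_subset_beta:
  assumes K: "compactin B K" "K \<subseteq> U"
  obtains S where "small S" "K \<subseteq> \<beta> S"
proof -
  have "K \<subseteq> \<Union>(\<beta> ` {S. small S})" using K(2) by (auto simp: U_iff)
  moreover have "openin B C" if "C \<in> \<beta> ` {S. small S}" for C
    using that openin_beta small_subset_carrier by auto
  ultimately obtain \<F> where F: "finite \<F>" "\<F> \<subseteq> \<beta> ` {S. small S}" "K \<subseteq> \<Union>\<F>"
    using compactinD[OF K(1), of "\<beta> ` {S. small S}"] by metis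
  then obtain \<S> where S: "finite \<S>" "\<S> \<subseteq> {S. small S}" "\<F> = \<beta> ` \<S>"
    using finite_subset_image by metis
  show ?thesis
  proof
    show "small (\<Union>S\<in>\<S>. S)"
      using S by (intro small_UN) (auto intro: countable_finite)
    have "\<beta> T \<subseteq> \<beta> (\<Union>S\<in>\<S>. S)" if "T \<in> \<S>" for T
      using that by (intro beta_mono) auto
    then show "K \<subseteq> \<beta> (\<Union>S\<in>\<S>. S)" using F(3) S(3) by blast
  qed
qed

text \<open>Points where \<open>g\<close> is nonzero lie in one of countably many compact sets, hence in countably
  many $\beta (S_n)$ with $S_n$ small; and a point of \<open>\<Lambda>\<close> lies in
  $\beta (S_n)$ only if it lies in $S_n$.\<close>

lemma C0_small_support:
  assumes g: "g \<in> C0 (subtopology B U)"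
  shows "small {t \<in> \<Lambda>. g (e t) \<noteq> 0}"
proof -
  define K where "K n = {p \<in> U. inverse (real (Suc n)) \<le> cmod (g p)}" for n
  have "compactin B (K n)" "K n \<subseteq> U" for n
    using g unfolding K_def C0_U_iff by auto
  then have "\<exists>S. small S \<and> K n \<subseteq> \<beta> S" for n
    by (meson compact_subset_beta)
  then obtain S where S: "\<And>n. small (S n)" "\<And>n. K n \<subseteq> \<beta> (S n)" by metis
  have "t \<in> (\<Union>n. S n)" if t: "t \<in> \<Lambda>" "g (e t) \<noteq> 0" for t
  proof -
    obtain n where "inverse (real (Suc n)) < cmod (g (e t))"
      using reals_Archimedean[of "cmod (g (e t))"] t by auto
    then have "e t \<in> K n" using t embedding_in_U by (simp add: K_def)
    then have "t \<in> S n"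
      using S embedding_in_beta_iff[OF t(1)] small_subset_carrier by blast
    then show ?thesis by blast
  qed
  then have "{t \<in> \<Lambda>. g (e t) \<noteq> 0} \<subseteq> (\<Union>n. S n)" by blast
  moreover have "small (\<Union>n. S n)" using S by (intro small_UN) auto
  ultimately show ?thesis using small_mono by blast
qed

lemma C0_bounded:
  assumes g: "g \<in> C0 Y"
  shows "bounded (g ` topspace Y)"
proof -
  let ?K = "{x \<in> topspace Y. 1 \<le> cmod (g x)}"
  have "compactin Y ?K" "continuous_map Y euclidean g"
    using g by (auto simp: C0_def)
  then have "bounded (g ` ?K)"
    using image_compactin[of Y ?K euclidean g] by (auto intro: compact_imp_bounded)
  moreover have "g ` topspace Y \<subseteq> g ` ?K \<union> cball 0 1"
    by auto
  ultimately show ?thesis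
    by (meson bounded_Un bounded_cball bounded_subset)
qed

text \<open>A function vanishing at infinity on \<open>U\<close> is determined by its values on the image of
  \<open>\<Lambda>\<close>, which is dense in \<open>U\<close> because \<open>U\<close> is contained in the closure of the image.\<close>

lemma C0_extends:
  assumes g: "g \<in> C0 (subtopology B U)"
  obtains f where "f \<in> A" "restrict (ext f) U = g"
proof
  define f where "f = (\<lambda>t\<in>\<Lambda>. g (e t))"
  have "f ` \<Lambda> \<subseteq> g ` U" by (auto simp: f_def embedding_in_U)
  then have "bounded (f ` \<Lambda>)"
    using bounded_subset C0_bounded[OF g] unfolding topspace_U by blast
  then have "f \<in> Cb (discrete_topology \<Lambda>)"
    by (simp add: Cb_discrete_iff f_def)
  then show f: "f \<in> A"
    by (rule A_I[OF _ C0_small_support[OF g]]) (auto simp: f_def)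
  show "restrict (ext f) U = g"
  proof (rule extensionalityI[of _ U])
    fix p assume p: "p \<in> U"
    have "ext f p = g p"
    proof (rule forall_in_closure_of_eq[of p "subtopology B U" "e ` \<Lambda>" euclidean])
      have "U \<inter> e ` \<Lambda> = e ` \<Lambda>" using embedding_in_U by auto
      then show "p \<in> subtopology B U closure_of e ` \<Lambda>"
        using p U_subset dense_image by (auto simp: closure_of_subtopology)
      show "continuous_map (subtopology B U) euclidean (ext f)"
        by (intro continuous_map_from_subtopology ext_continuous A_Cb f)
      show "continuous_map (subtopology B U) euclidean g" using g by (simp add: C0_def)
      show "ext f q = g q" if "q \<in> e ` \<Lambda>" for q
        using that ext_embedding[OF A_Cb[OF f]] by (auto simp: f_def)
    qed simp
    then show "restrict (ext f) U p = g p" using p by simp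
  qed (use g in \<open>auto simp: C0_U_iff\<close>)
qed

lemma ext_inj: "inj_on (\<lambda>f. restrict (ext f) U) A"
proof (rule inj_onI)
  fix f g assume fg: "f \<in> A" "g \<in> A" "restrict (ext f) U = restrict (ext g) U"
  show "f = g"
  proof (rule extensionalityI[of _ \<Lambda>])
    fix t assume t: "t \<in> \<Lambda>"
    have "ext f (e t) = ext g (e t)"
      using fun_cong[OF fg(3), of "e t"] embedding_in_U[OF t] by simp
    then show "f t = g t" using ext_embedding[OF A_Cb] fg t by simp
  qed (use fg A_Cb in \<open>auto simp: Cb_discrete_iff\<close>)
qed

lemma star_isomorphic_C0: "star_isomorphic \<Lambda> A U (C0 (subtopology B U))"
  unfolding star_isomorphic_def
proof (intro exI[of _ "\<lambda>f. restrict (ext f) U"] conjI ballI allI)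
  show "bij_betw (\<lambda>f. restrict (ext f) U) A (C0 (subtopology B U))"
    unfolding bij_betw_def using ext_inj restrict_ext_C0 C0_extends by (auto simp: image_iff) metis
  have U: "p \<in> topspace B" if "p \<in> U" for p using that U_subset by blast
  fix f assume f: "f \<in> A"
  show "restrict (ext (fun_scale \<Lambda> c f)) U = fun_scale U c (restrict (ext f) U)" for c
    by (auto simp: fun_scale_def[of U] ext_simps A_Cb f U)
  show "restrict (ext (fun_cnj \<Lambda> f)) U = fun_cnj U (restrict (ext f) U)"
    by (auto simp: fun_cnj_def[of U] ext_simps A_Cb f U)
  fix g assume g: "g \<in> A"
  show "restrict (ext (fun_add \<Lambda> f g)) U = fun_add U (restrict (ext f) U) (restrict (ext g) U)"
    by (auto simp: fun_add_def[of U] ext_simps A_Cb f g U)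
  show "restrict (ext (fun_mult \<Lambda> f g)) U = fun_mult U (restrict (ext f) U) (restrict (ext g) U)"
    by (auto simp: fun_mult_def[of U] ext_simps A_Cb f g U)
qed

end

theorem theorem3p5:
  fixes \<Lambda> :: "'a set" and \<alpha> :: "'c rel"
    and \<beta>\<Lambda> :: "'b topology" and e :: "'a \<Rightarrow> 'b"
  assumes "uncountable \<Lambda>"
    and "Cinfinite \<alpha>" and "\<alpha> <o |\<Lambda>|"
    and "stone_cech (discrete_topology \<Lambda>) \<beta>\<Lambda> e"
  shows "let U = (\<Union>S\<in>{S. S \<subseteq> \<Lambda> \<and> |S| \<le>o \<alpha>}. beta_sub \<beta>\<Lambda> e S) in
           K_subset \<Lambda> \<alpha> \<beta>\<Lambda> e = U
         \<and> homeomorphic_map (subtopology \<beta>\<Lambda> U) (char_space \<Lambda> (Cb_supp \<Lambda> \<alpha>))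
             (point_char (discrete_topology \<Lambda>) \<beta>\<Lambda> e (Cb_supp \<Lambda> \<alpha>))
         \<and> star_isomorphic \<Lambda> (Cb_supp \<Lambda> \<alpha>) U (C0 (subtopology \<beta>\<Lambda> U))"
proof -
  interpret small_support \<Lambda> \<beta>\<Lambda> e \<alpha>
    by unfold_locales (use assms in auto)
  show ?thesis
    unfolding Let_def U_def[symmetric]
    using K_subset_eq pc_homeomorphic star_isomorphic_C0 by blast
qed

end
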